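(* Let $a,b,c\in\mathbb{N}$ be perfect squares and suppose that either $a=c$ or $a+b=c$. Let $d\in\mathbb{N}$, let $f_1,\dots,f_d\in\mathcal{M}$ and let $I\subset\mathbb{S}^1$ be an open set containing $1$. Then there exist $x,y,z\in\mathbb{N}$ with $ax^2+by^2=cz^2$ such that $f_i(x),f_i(y),f_i(z)\in I$ for all $i=1,\dots,d$.
   Context: $\mathbb{N}=\{1,2,3,\dots\}$ and $\mathbb{S}^1=\{z\in\mathbb{C}:|z|=1\}$. $\mathcal{M}$ denotes the set of all completely multiplicative functions $f:\mathbb{N}\to\mathbb{S}^1$, i.e. functions satisfying $f(nm)=f(n)f(m)$ for all $m,n\in\mathbb{N}$. *)

theory Defs
  imports "HOL-Analysis.Analysis" "HOL-Computational_Algebra.Nth_Powers"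
begin

(* The natural numbers of the source start at 1, so nothing is required of the (junk) value f 0. *)
definition completely_multiplicative :: "(nat \<Rightarrow> complex) set" where
  "completely_multiplicative =
     {f \<in> {0<..} \<rightarrow> sphere 0 1. \<forall>m>0. \<forall>n>0. f (n * m) = f n * f m}"

end

theory Submission
  imports Defs
begin

text \<open>
  If \<open>a + b = c\<close>, take \<open>x = y = z = 1\<close>. For \<open>a = c\<close>, put \<open>l = sqrt (a / b)\<close>; it suffices to find rational
  \<open>X\<^sup>2 + Y\<^sup>2 = Z\<^sup>2\<close> such that all \<open>f i\<close>, extended to the nonzero rationals, are close to 1 at \<open>X\<close>,
  \<open>l * Y\<close> and \<open>Z\<close>: some power of a common denominator has the same property, and clears denominators.
  Van der Waerden's theorem gives a rational \<open>t\<close> such that all \<open>f i\<close> are close to 1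
  at all translates \<open>t + q\<close> with \<open>q\<close> in a prescribed finite set. Represent the triple by a Gaussian
  rational \<open>w\<close> with \<open>w\<^sup>2 = X + i Y\<close> and \<open>Z\<close> the norm of \<open>w\<close>. As \<open>X\<close> and \<open>Y\<close> split into rational
  linear factors, multiplying \<open>w\<close> by \<open>t + i r\<close> hardly changes the values of the \<open>f i\<close> at \<open>X\<close> and \<open>Y\<close>,
  while \<open>Z\<close> is multiplied by the uncontrolled number \<open>t\<^sup>2 + r\<^sup>2\<close>. With \<open>2 * l * r = 1\<close> one builds
  successively a sequence \<open>w 0, w 1, \<dots>\<close> for which the product of every block of consecutive terms has
  good values at \<open>X\<close> and \<open>l * Y\<close>; by the pigeonhole principle applied to the partial products of the
  norms, some block has a good value at \<open>Z\<close> as well.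
\<close>

section \<open>Van der Waerden's theorem by colour focusing\<close>

text \<open>The bound also covers \<open>a + k * D\<close>, the term after the \<open>k\<close>
  monochromatic ones: it is the point at which progressions are focused in the induction
  step.\<close>

lemma van_der_Waerden:
  "\<exists>N. \<forall>c :: nat \<Rightarrow> nat. (\<forall>x. c x < r) \<longrightarrow>
     (\<exists>a D col. D > 0 \<and> a + k * D < N \<and> (\<forall>j<k. c (a + j * D) = col))"
proof (induction k arbitrary: r)
  case 0
  show ?case by (rule exI[of _ 1]) (auto intro: exI[of _ "1 :: nat"])
next
  case (Suc k)
  note IH = Suc.IH
  define ap where "ap = (\<lambda>c N. \<exists>a D col. D > 0 \<and> a + k * D < N \<and>
    (\<forall>j\<le>k. c (a + j * D) = (col :: nat)))"
  define spoke where "spoke = (\<lambda>c e col. \<exists>a D. D > 0 \<and> a + k * D = e \<and> (\<forall>j<k. c (a + j * D) = (col :: nat)))"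
  \<comment> \<open>Unless a monochromatic progression of \<open>k + 1\<close> terms exists,
    \<open>s\<close> progressions of \<open>k\<close> terms with distinct colours share their next
    term \<open>e\<close>. Taking \<open>s\<close> larger than the number of colours rules out this
    alternative.\<close>
  have focus: "\<exists>N. \<forall>c. (\<forall>x. c x < r) \<longrightarrow>
      ap c N \<or> (\<exists>e<N. \<exists>T\<subseteq>{..<r}. card T = s \<and> (\<forall>col\<in>T. spoke c e col))" for s
  proof (induction s)
    case 0
    show ?case by (rule exI[of _ 1]) (auto intro!: exI[of _ "{}"])
  next
    case (Suc s)
    then obtain M where M: "\<forall>c. (\<forall>x. c x < r) \<longrightarrow>
      ap c M \<or> (\<exists>e<M. \<exists>T\<subseteq>{..<r}. card T = s \<and> (\<forall>col\<in>T. spoke c e col))" by (rule exE)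
    \<comment> \<open>Each interval of \<open>M\<close> integers is coloured by its whole pattern.
      The outer induction hypothesis with \<open>card words\<close> colours then gives equally
      spaced intervals with identical patterns.\<close>
    define words where "words = {l. set l \<subseteq> {..<r} \<and> length l = M}"
    have "finite words" unfolding words_def by (rule finite_lists_length_eq) simp
    then obtain h where h: "bij_betw h words {0..<card words}"
      using ex_bij_betw_finite_nat by blast
    obtain N where N: "\<forall>c. (\<forall>x. c x < card words) \<longrightarrow>
        (\<exists>a D col. D > 0 \<and> a + k * D < N \<and> (\<forall>j<k. c (a + j * D) = col))"
      using IH[of "card words"] by (rule exE)
    show ?case
    proof (intro exI[of _ "N * M"] allI impI)
      fix c :: "nat \<Rightarrow> nat" assume c: "\<forall>x. c x < r"
      define block where "block = (\<lambda>x. map (\<lambda>y. c (x * M + y)) [0..<M])"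
      have block: "block x \<in> words" for x using c by (auto simp: block_def words_def)
      have "\<forall>x. h (block x) < card words"
        using bij_betwE[OF h] block by simp
      from N[THEN spec, THEN mp, OF this] obtain x D col where D: "D > 0" and xN: "x + k * D < N"
        and col: "\<forall>j<k. h (block (x + j * D)) = col" by blast
      have same: "c ((x + j * D) * M + y) = c (x * M + y)" if "j < k" "y < M" for j y
      proof -
        have "h (block (x + j * D)) = h (block (x + 0 * D))"
          using col[rule_format, of j] col[rule_format, of 0] that(1) by simp
        from inj_onD[OF bij_betw_imp_inj_on[OF h] this block block]
        have "block (x + j * D) = block x" by simp
        hence "block (x + j * D) ! y = block x ! y" by simp
        thus ?thesis using that by (simp add: block_def)
      qed
      have inN: "(x + k * D) * M + y < N * M" if "y < M" for y
      proof -
        have "(x + k * D) * M + y < (x + k * D + 1) * M" using that by simp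
        also have "\<dots> \<le> N * M" using xN by (intro mult_right_mono) auto
        finally show ?thesis .
      qed
      have inN': "x * M + y < N * M" if "y < M" for y
        using inN[OF that] by (simp add: algebra_simps)
      define c' where "c' = (\<lambda>y. c (x * M + y))"
      have "\<forall>y. c' y < r" using c by (simp add: c'_def)
      from M[THEN spec, THEN mp, OF this]
      show "ap c (N * M) \<or> (\<exists>e<N * M. \<exists>T\<subseteq>{..<r}. card T = Suc s \<and> (\<forall>col\<in>T. spoke c e col))"
      proof (elim disjE exE conjE)
        assume "ap c' M"
        then obtain a E l where *: "E > 0" "a + k * E < M" "\<forall>j\<le>k. c' (a + j * E) = l"
          unfolding ap_def by blast
        hence "ap c (N * M)" unfolding ap_def
          using inN'[of "a + k * E"]
          by (intro exI[of _ "x * M + a"] exI[of _ E] exI[of _ l]) (auto simp: c'_def algebra_simps)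
        thus ?thesis ..
      next
        fix e T assume e: "e < M" and T: "T \<subseteq> {..<r}" "card T = s" "\<forall>col\<in>T. spoke c' e col"
        show ?thesis
        \<comment> \<open>If the focus has the colour of one of its spokes, it prolongs that spoke.
          Otherwise the focus moves to the copy of \<open>e\<close> in interval
          \<open>x + k * D\<close>: old spokes get difference \<open>D * M + E\<close>, and the
          copies of \<open>e\<close> in the preceding intervals of the progression form a spoke of a
          new colour.\<close>
        proof (cases "c' e \<in> T")
          case True
          with T(3) have "spoke c' e (c' e)" by (rule bspec)
          then obtain a E where *: "E > 0" "a + k * E = e" "\<forall>j<k. c' (a + j * E) = c' e"
            unfolding spoke_def by blast
          have "c' (a + j * E) = c' e" if "j \<le> k" for j
            using * that by (cases "j = k") auto
          hence "ap c (N * M)" unfolding ap_def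
            using inN'[of e] e *
            by (intro exI[of _ "x * M + a"] exI[of _ E] exI[of _ "c' e"]) (auto simp: c'_def algebra_simps)
          thus ?thesis ..
        next
          case False
          have "spoke c ((x + k * D) * M + e) l" if "l \<in> insert (c' e) T" for l
          proof (cases "l = c' e")
            case True
            show ?thesis unfolding spoke_def
            proof (intro exI conjI allI impI)
              show "D * M > 0" using D e by simp
              show "(x * M + e) + k * (D * M) = (x + k * D) * M + e" by (simp add: algebra_simps)
              fix j assume "j < k"
              from same[OF this e] show "c (x * M + e + j * (D * M)) = l"
                using True by (simp add: c'_def algebra_simps)
            qed
          next
            case False
            with that have "l \<in> T" by simp
            with T(3) have "spoke c' e l" by (rule bspec)
            then obtain a E where *: "E > 0" "a + k * E = e" "\<forall>j<k. c' (a + j * E) = l"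
              unfolding spoke_def by blast
            show ?thesis unfolding spoke_def
            proof (intro exI conjI allI impI)
              show "D * M + E > 0" using * by simp
              show "(x * M + a) + k * (D * M + E) = (x + k * D) * M + e"
                using * by (simp add: algebra_simps)
              fix j assume j: "j < k"
              hence "a + j * E < M" using * e mult_le_mono1[of j k E] by linarith
              from same[OF j this] have "c (x * M + a + j * (D * M + E)) = c' (a + j * E)"
                by (simp add: c'_def algebra_simps)
              with * j show "c (x * M + a + j * (D * M + E)) = l" by simp
            qed
          qed
          moreover have "card (insert (c' e) T) = Suc s"
            using False T finite_subset[OF T(1)] by simp
          moreover have "insert (c' e) T \<subseteq> {..<r}" using T c by (auto simp: c'_def)
          ultimately show ?thesis
            by (intro disjI2 exI[of _ "(x + k * D) * M + e"] exI[of _ "insert (c' e) T"] conjI ballI inN[OF e])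
        qed
      qed
    qed
  qed
  obtain N where N: "\<forall>c. (\<forall>x. c x < r) \<longrightarrow>
      ap c N \<or> (\<exists>e<N. \<exists>T\<subseteq>{..<r}. card T = Suc r \<and> (\<forall>col\<in>T. spoke c e col))"
    using focus[of "Suc r"] by (rule exE)
  have no_T: "card T \<noteq> Suc r" if "T \<subseteq> {..<r}" for T
    using card_mono[OF _ that] by auto
  have ap: "ap c N" if "\<forall>x. c x < r" for c
    using N[THEN spec, THEN mp, OF that] no_T by auto
  show ?case
  proof (rule exI[of _ "2 * N"], intro allI impI)
    fix c :: "nat \<Rightarrow> nat" assume "\<forall>x. c x < r"
    from ap[OF this] obtain a D col where *: "D > 0" "a + k * D < N" "\<forall>j\<le>k. c (a + j * D) = col"
      unfolding ap_def by blast
    \<comment> \<open>For \<open>k = 0\<close> the bound \<open>N\<close> does not restrict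
      \<open>D\<close>, so 1 replaces it; otherwise \<open>D \<le> k * D < N\<close>, whence the
      bound \<open>2 * N\<close>.\<close>
    define E where "E = (if k = 0 then 1 else D)"
    have "a + Suc k * E < 2 * N" using * by (cases k) (auto simp: E_def algebra_simps)
    moreover have "\<forall>j<Suc k. c (a + j * E) = col" "E > 0" using * by (auto simp: E_def)
    ultimately show "\<exists>a D col. D > 0 \<and> a + Suc k * D < 2 * N \<and> (\<forall>j<Suc k. c (a + j * D) = col)"
      by blast
  qed
qed

section \<open>Gaussian rationals and Pythagorean triples\<close>

text \<open>Multiplication of Gaussian rationals, with \<open>(m, n)\<close> standing for m + i
  n.\<close>

definition gmul :: "rat \<times> rat \<Rightarrow> rat \<times> rat \<Rightarrow> rat \<times> rat" where
  "gmul \<kappa> w = (fst \<kappa> * fst w - snd \<kappa> * snd w, fst \<kappa> * snd w + snd \<kappa> * fst w)"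

text \<open>The real part of the square of a Gaussian rational; \<open>leg2\<close> is the imaginary
  part.\<close>

definition leg1 :: "rat \<times> rat \<Rightarrow> rat" where
  "leg1 w = (fst w)\<^sup>2 - (snd w)\<^sup>2"

definition leg2 :: "rat \<times> rat \<Rightarrow> rat" where
  "leg2 w = 2 * fst w * snd w"

definition hyp :: "rat \<times> rat \<Rightarrow> rat" where
  "hyp w = (fst w)\<^sup>2 + (snd w)\<^sup>2"

lemma legs_hyp: "(leg1 w)\<^sup>2 + (leg2 w)\<^sup>2 = (hyp w)\<^sup>2"
  by (simp add: leg1_def leg2_def hyp_def power2_eq_square algebra_simps)

lemma hyp_gmul: "hyp (gmul \<kappa> w) = hyp \<kappa> * hyp w"
  by (simp add: gmul_def hyp_def power2_eq_square algebra_simps)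

text \<open>The product of \<open>w i, ..., w (j - 1)\<close>; the default \<open>(1, 0)\<close> is
  the Gaussian unit and serves as the empty product.\<close>

fun block :: "(nat \<Rightarrow> rat \<times> rat) \<Rightarrow> nat \<Rightarrow> nat \<Rightarrow> rat \<times> rat" where
  "block w i 0 = (1, 0)"
| "block w i (Suc j) = (if i \<le> j then gmul (block w i j) (w j) else (1, 0))"

lemma block_cong: "(\<And>k. k < j \<Longrightarrow> w k = v k) \<Longrightarrow> block w i j = block v i j"
  by (induction j) auto

lemma block_refl: "block w i i = (1, 0)"
  by (cases i) auto

lemma hyp_block: "i \<le> j \<Longrightarrow> hyp (block w i j) = (\<Prod>k\<in>{i..<j}. hyp (w k))"
proof (induction j)
  case 0
  then show ?case by (simp add: hyp_def)
next
  case (Suc j)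
  show ?case
  proof (cases "i = Suc j")
    case True
    then show ?thesis by (simp add: hyp_def)
  next
    case False
    then show ?thesis using Suc by (simp add: hyp_gmul)
  qed
qed

section \<open>Characters of the nonzero rationals and their values near 1\<close>

lemma ex_common_denominator:
  assumes "finite (R :: rat set)"
  obtains M :: nat where "M > 0" "\<forall>r\<in>R. \<exists>j::int. of_nat M * r = of_int j"
  using assms
proof (induction R arbitrary: thesis rule: finite_induct)
  case empty
  show ?case by (rule empty[of 1]) auto
next
  case (insert r R)
  obtain M :: nat where M: "M > 0" "\<forall>r\<in>R. \<exists>j::int. of_nat M * r = of_int j"
    by (rule insert.IH)
  obtain u v where uv: "quotient_of r = (u, v)" by fastforce
  have v: "v > 0" "r = of_int u / of_int v"
    using quotient_of_denom_pos[OF uv] quotient_of_div[OF uv] by auto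
  show ?case
  proof (rule insert.prems[of "M * nat v"])
    show "M * nat v > 0" using M v by simp
    have V: "of_nat (nat v) = (of_int v :: rat)" using v by simp
    show "\<forall>r\<in>insert r R. \<exists>j::int. of_nat (M * nat v) * r = of_int j"
    proof
      fix q assume q: "q \<in> insert r R"
      show "\<exists>j::int. of_nat (M * nat v) * q = of_int j"
      proof (cases "q = r")
        case True
        have "of_nat (M * nat v) * q = (of_int (int M * u) :: rat)"
          using v True V by (simp add: field_simps)
        thus ?thesis by blast
      next
        case False
        with q M obtain j :: int where "of_nat M * q = of_int j" by blast
        hence "of_nat (M * nat v) * q = (of_int (j * v) :: rat)" using V
          by (simp add: algebra_simps)
        thus ?thesis by blast
      qed
    qed
  qed
qed

text \<open>Triviality at -1 makes the characters even, so signs of rationals can be ignored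
  throughout.\<close>

locale rat_characters =
  fixes J :: "'i set" and F :: "'i \<Rightarrow> rat \<Rightarrow> complex"
  assumes finite_J: "finite J"
    and norm_F: "\<And>i q. i \<in> J \<Longrightarrow> q \<noteq> 0 \<Longrightarrow> norm (F i q) = 1"
    and F_mult: "\<And>i p q. i \<in> J \<Longrightarrow> p \<noteq> 0 \<Longrightarrow> q \<noteq> 0 \<Longrightarrow> F i (p * q) = F i p * F i q"
    and F_minus_one: "\<And>i. i \<in> J \<Longrightarrow> F i (-1) = 1"
begin

definition near :: "real \<Rightarrow> rat \<Rightarrow> bool" where
  "near \<epsilon> q \<longleftrightarrow> q \<noteq> 0 \<and> (\<forall>i\<in>J. norm (F i q - 1) < \<epsilon>)"

lemma near_nonzero: "near \<epsilon> q \<Longrightarrow> q \<noteq> 0"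
  by (simp add: near_def)

lemma near_mono: "near \<epsilon> q \<Longrightarrow> \<epsilon> \<le> \<delta> \<Longrightarrow> near \<delta> q"
  by (force simp: near_def)

lemma near_mult:
  assumes "near \<epsilon> p" and "near \<delta> q"
  shows "near (\<epsilon> + \<delta>) (p * q)"
  unfolding near_def
proof (intro conjI ballI)
  show "p * q \<noteq> 0" using assms by (simp add: near_def)
  fix i assume i: "i \<in> J"
  have pq: "p \<noteq> 0" "q \<noteq> 0" using assms by (simp_all add: near_def)
  have "F i (p * q) - 1 = F i p * (F i q - 1) + (F i p - 1)"
    using F_mult[OF i pq] by (simp add: algebra_simps)
  also have "norm \<dots> \<le> norm (F i q - 1) + norm (F i p - 1)"
    using norm_triangle_ineq[of "F i p * (F i q - 1)" "F i p - 1"] norm_F[OF i pq(1)]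
    by (simp add: norm_mult)
  also have "\<dots> < \<delta> + \<epsilon>"
    using assms i by (intro add_strict_mono) (simp_all add: near_def)
  finally show "norm (F i (p * q) - 1) < \<epsilon> + \<delta>" by simp
qed

lemma near_minus [simp]: "near \<epsilon> (- q) \<longleftrightarrow> near \<epsilon> q"
proof (cases "q = 0")
  case False
  hence "F i (- q) = F i q" if "i \<in> J" for i
    using F_mult[OF that, of "-1" q] F_minus_one[OF that] by simp
  thus ?thesis using False by (simp add: near_def)
qed simp

lemma near_abs [simp]: "near \<epsilon> \<bar>q\<bar> \<longleftrightarrow> near \<epsilon> q"
  by (simp add: abs_if)

text \<open>The circle is totally bounded: colour \<open>q\<close> by the centres of balls of radius
  \<open>\<epsilon> / 2\<close> that contain the values \<open>F i q\<close>. Equal colours put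
  \<open>F i p\<close> within \<epsilon> of \<open>F i q\<close>, and dividing by a unimodular
  number preserves the distance.\<close>

lemma ex_finite_colouring:
  assumes "\<epsilon> > 0"
  shows "\<exists>\<phi> :: rat \<Rightarrow> nat. \<exists>r. (\<forall>q. \<phi> q < r) \<and>
           (\<forall>p q. p \<noteq> 0 \<longrightarrow> q \<noteq> 0 \<longrightarrow> \<phi> p = \<phi> q \<longrightarrow> near \<epsilon> (p / q))"
proof -
  have "seq_compact (sphere (0 :: complex) 1)"
    by (simp add: compact_imp_seq_compact)
  from seq_compact_imp_totally_bounded[OF this, rule_format, OF half_gt_zero[OF assms]]
  obtain K where K: "finite K" "sphere (0 :: complex) 1 \<subseteq> (\<Union>x\<in>K. ball x (\<epsilon> / 2))"
    by blast
  have "\<exists>x. x \<in> K \<and> dist x (F i q) < \<epsilon> / 2" if "i \<in> J" "q \<noteq> 0" for i q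
  proof -
    have "F i q \<in> sphere 0 1" using norm_F[OF that] by simp
    from subsetD[OF K(2) this] show ?thesis by auto
  qed
  then obtain g where g: "\<And>i q. i \<in> J \<Longrightarrow> q \<noteq> 0 \<Longrightarrow> g i q \<in> K \<and> dist (g i q) (F i q) < \<epsilon> / 2"
    by metis
  define A where "A = (\<Pi>\<^sub>E i\<in>J. K)"
  have "finite A" unfolding A_def using finite_J K(1) by (intro finite_PiE) auto
  then obtain h where h: "bij_betw h A {0..<card A}" using ex_bij_betw_finite_nat by blast
  \<comment> \<open>Zero is given the colour of 1, so that the colouring is total.\<close>
  define G where "G = (\<lambda>q. restrict (\<lambda>i. g i (if q = 0 then 1 else q)) J)"
  have G: "G q \<in> A" for q unfolding G_def A_def using g by auto
  show ?thesis
  proof (intro exI conjI allI impI)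
    show "h (G q) < card A" for q using bij_betwE[OF h] G by simp
    fix p q :: rat assume pq: "p \<noteq> 0" "q \<noteq> 0" "h (G p) = h (G q)"
    have eq: "G p = G q" by (rule inj_onD[OF bij_betw_imp_inj_on[OF h] pq(3) G G])
    show "near \<epsilon> (p / q)" unfolding near_def
    proof (intro conjI ballI)
      show "p / q \<noteq> 0" using pq by simp
      fix i assume i: "i \<in> J"
      have "g i p = g i q" using fun_cong[OF eq, of i] i pq by (simp add: G_def)
      moreover have "dist (g i p) (F i p) < \<epsilon> / 2" "dist (g i q) (F i q) < \<epsilon> / 2"
        using g[OF i] pq by auto
      ultimately have d: "dist (F i p) (F i q) < \<epsilon>"
        using dist_triangle_half_r[of "g i p" "F i p" \<epsilon> "F i q"] by simp
      have "F i p = F i (p / q) * F i q" using F_mult[OF i, of "p / q" q] pq by simp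
      hence "F i p - F i q = (F i (p / q) - 1) * F i q" by (simp add: algebra_simps)
      hence "norm (F i p - F i q) = norm (F i (p / q) - 1)"
        using norm_F[OF i pq(2)] by (simp add: norm_mult)
      thus "norm (F i (p / q) - 1) < \<epsilon>" using d by (simp add: dist_norm)
    qed
  qed
qed

text \<open>One representative of each colour suffices.\<close>

lemma ex_finite_net:
  assumes "\<epsilon> > 0"
  shows "\<exists>S. finite S \<and> 0 \<notin> S \<and> (\<forall>q. q \<noteq> 0 \<longrightarrow> (\<exists>s\<in>S. near \<epsilon> (q / s)))"
proof -
  obtain \<phi> :: "rat \<Rightarrow> nat" and r where \<phi>: "\<And>q. \<phi> q < r"
    "\<And>p q. p \<noteq> 0 \<Longrightarrow> q \<noteq> 0 \<Longrightarrow> \<phi> p = \<phi> q \<Longrightarrow> near \<epsilon> (p / q)"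
    using ex_finite_colouring[OF assms] by blast
  have "finite (\<phi> ` (- {0}))" by (rule finite_subset[of _ "{..<r}"]) (use \<phi>(1) in auto)
  from finite_subset_image[OF this subset_refl]
  obtain S where S: "S \<subseteq> - {0}" "finite S" "\<phi> ` (- {0}) = \<phi> ` S"
    by metis
  have "\<exists>s\<in>S. near \<epsilon> (q / s)" if "q \<noteq> 0" for q
  proof -
    have "\<phi> q \<in> \<phi> ` S" unfolding S(3)[symmetric] using that by simp
    then obtain s where "s \<in> S" "\<phi> q = \<phi> s" by blast
    thus ?thesis using \<phi>(2) S(1) that by blast
  qed
  moreover have "0 \<notin> S" using S(1) by auto
  ultimately show ?thesis using S(2) by blast
qed

lemma ex_near_constant_translates:
  assumes "\<epsilon> > 0" and "finite R"
  shows "\<exists>t g. g \<noteq> 0 \<and> (\<forall>r\<in>R. near \<epsilon> ((t + r) / g))"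
proof -
  obtain \<phi> :: "rat \<Rightarrow> nat" and n where \<phi>: "\<And>q. \<phi> q < n"
    "\<And>p q. p \<noteq> 0 \<Longrightarrow> q \<noteq> 0 \<Longrightarrow> \<phi> p = \<phi> q \<Longrightarrow> near \<epsilon> (p / q)"
    using ex_finite_colouring[OF assms(1)] by blast
  obtain M :: nat where M: "M > 0" "\<forall>r\<in>R. \<exists>j::int. of_nat M * r = of_int j"
    using ex_common_denominator[OF assms(2)] by blast
  then obtain j where j: "\<And>r. r \<in> R \<Longrightarrow> of_nat M * r = of_int (j r)" by metis
  \<comment> \<open>The integers \<open>M * r\<close> lie between \<open>-L\<close> and
    \<open>L\<close>, so a progression of \<open>2 * L + 1\<close> terms has room for all
    shifts.\<close>
  define L where "L = Max (insert 0 ((\<lambda>r. nat \<bar>j r\<bar>) ` R))"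
  have L: "nat \<bar>j r\<bar> \<le> L" if "r \<in> R" for r
    unfolding L_def using that assms(2) by (intro Max_ge) auto
  obtain N where N: "\<And>c :: nat \<Rightarrow> nat. (\<forall>x. c x < n) \<Longrightarrow>
      \<exists>a D col. D > 0 \<and> a + (2 * L + 1) * D < N \<and> (\<forall>j<2 * L + 1. c (a + j * D) = col)"
    using van_der_Waerden[of n "2 * L + 1"] by blast
  obtain a D col where D: "D > 0"
    and col: "\<And>j. j < 2 * L + 1 \<Longrightarrow> \<phi> (of_nat (Suc (a + j * D))) = col"
    using N[of "\<lambda>x. \<phi> (of_nat (Suc x))"] \<phi>(1) by blast
  \<comment> \<open>Dividing the progression by \<open>D * M\<close> turns its step into
    \<open>1 / M\<close>. Then \<open>g\<close> is the first term, \<open>t\<close> the middle one,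
    and \<open>t + r\<close> the term of index \<open>L + M * r\<close>.\<close>
  define g :: rat where "g = of_nat (Suc a) / (of_nat D * of_nat M)"
  define t :: rat where "t = of_nat (Suc (a + L * D)) / (of_nat D * of_nat M)"
  show ?thesis
  proof (intro exI conjI ballI)
    show "g \<noteq> 0" using D M by (simp add: g_def)
    fix r assume r: "r \<in> R"
    define l where "l = nat (int L + j r)"
    have l: "int l = int L + j r" "l < 2 * L + 1" using L[OF r] by (auto simp: l_def)
    have "near \<epsilon> (of_nat (Suc (a + l * D)) / of_nat (Suc (a + 0 * D)))"
      using col[OF l(2)] col[of 0] by (intro \<phi>(2)) (simp_all del: of_nat_Suc)
    moreover have "(t + r) / g = of_nat (Suc (a + l * D)) / of_nat (Suc (a + 0 * D))"
    proof -
      have "(of_nat l :: rat) = of_int (int l)" by simp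
      also have "\<dots> = of_nat L + of_nat M * r" unfolding l(1) using j[OF r] by simp
      finally have "(of_nat l :: rat) = of_nat L + of_nat M * r" .
      hence eq: "(of_nat (Suc (a + l * D)) :: rat) = of_nat (Suc (a + L * D)) + of_nat D * of_nat M * r"
        by (simp add: algebra_simps)
      define P :: rat where "P = of_nat D * of_nat M"
      have P: "P \<noteq> 0" using D M by (simp add: P_def)
      have "(u / P + r) / (v / P) = (u + P * r) / v" for u v
        using P by (simp add: add_divide_eq_iff distrib_left mult.commute)
      thus ?thesis unfolding eq t_def g_def P_def[symmetric] by (simp only: mult_zero_left add_0_right)
    qed
    ultimately show "near \<epsilon> ((t + r) / g)" by simp
  qed
qed

text \<open>The constant \<open>g\<close> above is removed by dividing by an element \<open>s\<close> of a finite net close to \<open>g\<close>;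
  this is possible because the translates by \<open>r * s\<close>, for all \<open>s\<close> of the net, were treated at once.\<close>

lemma ex_near_translates:
  assumes "\<epsilon> > 0" and "finite R"
  shows "\<exists>t. \<forall>r\<in>R. near \<epsilon> (t + r)"
proof -
  obtain S where S: "finite S" "0 \<notin> S" "\<And>q. q \<noteq> 0 \<Longrightarrow> \<exists>s\<in>S. near (\<epsilon> / 2) (q / s)"
    using ex_finite_net[of "\<epsilon> / 2"] assms(1) by auto
  have "finite ((\<lambda>(r, s). r * s) ` (R \<times> S))" using assms(2) S(1) by simp
  from ex_near_constant_translates[OF half_gt_zero[OF assms(1)] this]
  obtain t g where g: "g \<noteq> 0"
    "\<And>r. r \<in> (\<lambda>(r, s). r * s) ` (R \<times> S) \<Longrightarrow> near (\<epsilon> / 2) ((t + r) / g)"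
    by metis
  obtain s where s: "s \<in> S" "near (\<epsilon> / 2) (g / s)" using S(3)[OF g(1)] by blast
  have "near \<epsilon> (t / s + r)" if "r \<in> R" for r
  proof -
    have "near (\<epsilon> / 2 + \<epsilon> / 2) ((t + r * s) / g * (g / s))"
      by (rule near_mult[OF g(2) s(2)]) (use that s in auto)
    moreover have "(t + r * s) / g * (g / s) = t / s + r"
    proof -
      have "s \<noteq> 0" using s(1) S(2) by auto
      thus ?thesis using g(1) by (simp add: field_simps)
    qed
    ultimately show ?thesis by simp
  qed
  thus ?thesis by blast
qed

section \<open>Controlling the legs, then the hypotenuse\<close>

definition legs_near :: "real \<Rightarrow> rat \<Rightarrow> rat \<times> rat \<Rightarrow> bool" where
  "legs_near \<epsilon> l w \<longleftrightarrow> near \<epsilon> (leg1 w) \<and> near \<epsilon> (l * leg2 w)"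

text \<open>Apart from factors of \<open>\<kappa>\<close>, all linear factors of the legs of \<open>\<kappa> * (t + i r)\<close> are translates of \<open>t\<close>
  by rational numbers, or the constant \<open>r\<close>.\<close>

lemma ex_legs_near_gmul:
  assumes "finite K" and "\<delta> > 0" and "l \<noteq> 0"
  shows "\<exists>w. legs_near \<delta> l w \<and>
           (\<forall>\<kappa>\<in>K. \<forall>\<epsilon>. legs_near \<epsilon> l \<kappa> \<longrightarrow> legs_near (\<epsilon> + \<delta>) l (gmul \<kappa> w))"
proof -
  \<comment> \<open>With this choice the second leg of \<open>(t, r)\<close>, multiplied by
    \<open>l\<close>, is exactly \<open>t\<close>.\<close>
  define r where "r = 1 / (2 * l)"
  have r: "r \<noteq> 0" "2 * l * r = 1" using assms(3) by (auto simp: r_def)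
  \<comment> \<open>These are the constant terms of the four linear factors in \<open>t\<close> of
    the legs of the product, after division by their leading coefficients. The denominators are
    nonzero whenever both legs of \<kappa> are.\<close>
  define shifts where "shifts = (\<lambda>(m, n).
    {- n * r / m, m * r / n, (m - n) * r / (m + n), - (m + n) * r / (m - n)})"
  define R where "R = {0, r, -r} \<union> (\<Union>\<kappa>\<in>K. shifts \<kappa>)"
  have "finite (shifts \<kappa>)" for \<kappa> by (simp add: shifts_def split: prod.split)
  hence "finite R" using assms(1) by (simp add: R_def)
  then obtain t where t: "\<And>q. q \<in> R \<Longrightarrow> near (\<delta> / 2) (t + q)"
    using ex_near_translates[of "\<delta> / 2" R] assms(2) by auto
  have "legs_near \<delta> l (t, r)"
    unfolding legs_near_def
  proof
    have "near (\<delta> / 2 + \<delta> / 2) ((t + r) * (t + - r))"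
      by (intro near_mult t) (simp_all add: R_def)
    thus "near \<delta> (leg1 (t, r))" by (simp add: leg1_def power2_eq_square algebra_simps)
    have "near \<delta> (t + 0)"
      by (rule near_mono[OF t]) (use assms(2) in \<open>simp_all add: R_def\<close>)
    moreover have "l * leg2 (t, r) = t * (2 * l * r)" by (simp add: leg2_def)
    ultimately show "near \<delta> (l * leg2 (t, r))" using r by simp
  qed
  moreover have "legs_near (\<epsilon> + \<delta>) l (gmul \<kappa> (t, r))" if \<kappa>: "\<kappa> \<in> K" "legs_near \<epsilon> l \<kappa>" for \<kappa> \<epsilon>
  proof -
    obtain m n where mn: "\<kappa> = (m, n)" by (cases \<kappa>)
    have legs: "leg1 \<kappa> = (m + n) * (m - n)" "leg2 \<kappa> = 2 * m * n"
      by (simp_all add: leg1_def leg2_def mn power2_eq_square algebra_simps)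
    moreover have "leg1 \<kappa> \<noteq> 0" "leg2 \<kappa> \<noteq> 0"
      using \<kappa>(2) by (auto simp: legs_near_def dest: near_nonzero)
    ultimately have nz: "m \<noteq> 0" "n \<noteq> 0" "m + n \<noteq> 0" "m - n \<noteq> 0"
      by simp_all
    have in_R: "shifts \<kappa> \<subseteq> R" using \<kappa>(1) by (auto simp only: R_def)
    define p q p' q' where "p = t + (m - n) * r / (m + n)" and "q = t + - (m + n) * r / (m - n)"
      and "p' = t + - n * r / m" and "q' = t + m * r / n"
    note defs = this
    have near: "near (\<delta> / 2) p" "near (\<delta> / 2) q" "near (\<delta> / 2) p'" "near (\<delta> / 2) q'"
      unfolding defs by (rule t, rule subsetD[OF in_R], simp add: shifts_def mn)+
    have cancel: "c * (t + u * r / c) = c * t + u * r" if "c \<noteq> 0" for c u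
      using that by (simp add: field_simps)
    have factors: "(m + n) * p = (m + n) * t + (m - n) * r" "(m - n) * q = (m - n) * t + - (m + n) * r"
      "m * p' = m * t + - n * r" "n * q' = n * t + m * r"
      unfolding defs by (rule cancel, rule nz)+
    have "near (\<epsilon> + (\<delta> / 2 + \<delta> / 2)) (leg1 \<kappa> * (p * q))"
      using \<kappa>(2) by (intro near_mult near) (simp add: legs_near_def)
    moreover have "leg1 \<kappa> * (p * q) = ((m + n) * p) * ((m - n) * q)"
      by (simp add: legs)
    moreover have "((m + n) * p) * ((m - n) * q) = leg1 (gmul \<kappa> (t, r))"
      unfolding factors by (simp add: leg1_def gmul_def mn power2_eq_square algebra_simps)
    moreover have "near (\<epsilon> + (\<delta> / 2 + \<delta> / 2)) (l * leg2 \<kappa> * (p' * q'))"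
      using \<kappa>(2) by (intro near_mult near) (simp add: legs_near_def)
    moreover have "l * leg2 \<kappa> * (p' * q') = 2 * l * (m * p') * (n * q')"
      by (simp add: legs)
    moreover have "2 * l * (m * p') * (n * q') = l * leg2 (gmul \<kappa> (t, r))"
      unfolding factors by (simp add: leg2_def gmul_def mn algebra_simps)
    ultimately show ?thesis unfolding legs_near_def by (simp only: field_sum_of_halves)
  qed
  ultimately show ?thesis by (intro exI[of _ "(t, r)"] conjI ballI allI impI)
qed

text \<open>A new term is chosen simultaneously for the finitely many blocks ending just before it,
  and also works alone. Each factor costs \<delta>, so the error grows linearly with the length of
  the block.\<close>

lemma ex_legs_near_blocks:
  assumes "\<delta> > 0" and "l \<noteq> 0"
  shows "\<exists>w. \<forall>i j. i < j \<longrightarrow> j \<le> N \<longrightarrow> legs_near (real (j - i) * \<delta>) l (block w i j)"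
proof (induction N)
  case 0
  show ?case by simp
next
  case (Suc N)
  then obtain w where w: "\<And>i j. i < j \<Longrightarrow> j \<le> N \<Longrightarrow> legs_near (real (j - i) * \<delta>) l (block w i j)"
    by blast
  obtain v where v: "legs_near \<delta> l v"
    "\<And>i \<epsilon>. i < N \<Longrightarrow> legs_near \<epsilon> l (block w i N) \<Longrightarrow> legs_near (\<epsilon> + \<delta>) l (gmul (block w i N) v)"
    using ex_legs_near_gmul[of "(\<lambda>i. block w i N) ` {..<N}" \<delta> l] assms by auto
  define w' where "w' = w(N := v)"
  have old: "block w' i j = block w i j" if "j \<le> N" for i j
    by (rule block_cong) (use that in \<open>auto simp: w'_def\<close>)
  have "legs_near (real (j - i) * \<delta>) l (block w' i j)" if ij: "i < j" "j \<le> Suc N" for i j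
  proof -
    consider "j \<le> N" | "j = Suc N" "i < N" | "j = Suc N" "i = N" using ij by linarith
    thus ?thesis
    proof cases
      case 1
      thus ?thesis using w ij old by simp
    next
      case 2
      have "legs_near (real (N - i) * \<delta> + \<delta>) l (gmul (block w i N) v)"
        using v(2) w 2 by simp
      moreover have "real (N - i) * \<delta> + \<delta> = real (j - i) * \<delta>"
        using 2 by (simp add: of_nat_diff algebra_simps)
      ultimately show ?thesis using 2 old[of N i] by (simp add: w'_def)
    next
      case 3
      thus ?thesis using v(1) old[of N N] by (simp add: w'_def block_refl gmul_def)
    qed
  qed
  thus ?case by blast
qed

lemma ex_near_pythagorean:
  assumes "\<epsilon> > 0" and "l \<noteq> 0"
  shows "\<exists>x y z. x\<^sup>2 + y\<^sup>2 = z\<^sup>2 \<and> near \<epsilon> x \<and> near \<epsilon> (l * y) \<and> near \<epsilon> z"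
proof -
  obtain \<phi> :: "rat \<Rightarrow> nat" and N where \<phi>: "\<And>q. \<phi> q < N"
    "\<And>p q. p \<noteq> 0 \<Longrightarrow> q \<noteq> 0 \<Longrightarrow> \<phi> p = \<phi> q \<Longrightarrow> near \<epsilon> (p / q)"
    using ex_finite_colouring[OF assms(1)] by blast
  have N: "N > 0" using \<phi>(1)[of 0] by simp
  \<comment> \<open>Blocks have length at most \<open>N\<close>, the number of colours, so tolerance
    \<open>\<epsilon> / N\<close> per term keeps the legs within \<epsilon>.\<close>
  obtain w where w: "\<And>i j. i < j \<Longrightarrow> j \<le> N \<Longrightarrow> legs_near (real (j - i) * (\<epsilon> / N)) l (block w i j)"
    using ex_legs_near_blocks[of "\<epsilon> / N" l N] assms N by auto
  define P where "P = (\<lambda>j. \<Prod>k\<in>{0..<j}. hyp (w k))"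
  have hyp_nz: "hyp (w k) \<noteq> 0" if "k < N" for k
  proof -
    have "block w k (Suc k) = w k" by (simp add: block_refl gmul_def)
    hence "legs_near (\<epsilon> / N) l (w k)" using w[of k "Suc k"] that by simp
    hence "leg1 (w k) \<noteq> 0" using near_nonzero by (auto simp: legs_near_def)
    thus ?thesis by (auto simp: leg1_def hyp_def sum_power2_eq_zero_iff)
  qed
  \<comment> \<open>There are \<open>N + 1\<close> partial products but only \<open>N\<close>
    colours; the quotient of two of equal colour is the norm of the block between them.\<close>
  have "\<not> inj_on (\<lambda>j. \<phi> (P j)) {..N}"
    using card_inj_on_le[of "\<lambda>j. \<phi> (P j)" "{..N}" "{..<N}"] \<phi>(1) by auto
  then obtain i j where ij: "i < j" "j \<le> N" "\<phi> (P i) = \<phi> (P j)"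
    unfolding inj_on_def by (metis atMost_iff linorder_neqE_nat)
  have nz: "P i \<noteq> 0" "P j \<noteq> 0" using hyp_nz ij by (auto simp: P_def)
  have "P j = P i * hyp (block w i j)"
    unfolding P_def using ij by (simp add: hyp_block prod.atLeastLessThan_concat)
  hence "near \<epsilon> (hyp (block w i j))"
    using \<phi>(2)[OF nz(2,1) ij(3)[symmetric]] nz by simp
  moreover have "real (j - i) * (\<epsilon> / N) \<le> real N * (\<epsilon> / N)"
    using assms ij by (intro mult_right_mono) auto
  hence "real (j - i) * (\<epsilon> / N) \<le> \<epsilon>" using N by simp
  hence "near \<epsilon> (leg1 (block w i j))" "near \<epsilon> (l * leg2 (block w i j))"
    using w[OF ij(1,2)] near_mono unfolding legs_near_def by blast+
  ultimately show ?thesis using legs_hyp by blast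
qed

text \<open>Two powers of \<open>q\<close> share a colour, and their quotient is again a power of
  \<open>q\<close>.\<close>

lemma ex_near_power:
  assumes "\<epsilon> > 0" and "q \<noteq> 0"
  shows "\<exists>k>0. near \<epsilon> (q ^ k)"
proof -
  obtain \<phi> :: "rat \<Rightarrow> nat" and N where \<phi>: "\<And>q. \<phi> q < N"
    "\<And>p q. p \<noteq> 0 \<Longrightarrow> q \<noteq> 0 \<Longrightarrow> \<phi> p = \<phi> q \<Longrightarrow> near \<epsilon> (p / q)"
    using ex_finite_colouring[OF assms(1)] by blast
  have "\<not> inj_on (\<lambda>j. \<phi> (q ^ j)) {..N}"
    using card_inj_on_le[of "\<lambda>j. \<phi> (q ^ j)" "{..N}" "{..<N}"] \<phi>(1) by auto
  then obtain i j where ij: "i < j" "\<phi> (q ^ i) = \<phi> (q ^ j)"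
    unfolding inj_on_def by (metis linorder_neqE_nat)
  have "near \<epsilon> (q ^ j / q ^ i)" using \<phi>(2) ij assms(2) by simp
  hence "near \<epsilon> (q ^ (j - i))" using ij assms(2) by (simp add: power_diff)
  thus ?thesis using ij(1) by (intro exI[of _ "j - i"]) simp
qed


end

section \<open>Extending multiplicative functions to the rationals\<close>

definition rat_ext :: "(nat \<Rightarrow> complex) \<Rightarrow> rat \<Rightarrow> complex" where
  "rat_ext f q = f (nat \<bar>fst (quotient_of q)\<bar>) / f (nat (snd (quotient_of q)))"

lemma rat_ext_minus: "rat_ext f (- q) = rat_ext f q"
  by (simp add: rat_ext_def rat_uminus_code split: prod.split)

lemma rat_ext_abs: "rat_ext f \<bar>q\<bar> = rat_ext f q"
  by (simp add: abs_if rat_ext_minus)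

lemma abs_rat_cases:
  assumes "q \<noteq> (0 :: rat)"
  obtains m n :: nat where "m > 0" "n > 0" "\<bar>q\<bar> = of_nat m / of_nat n"
proof -
  obtain u v where uv: "quotient_of \<bar>q\<bar> = (u, v)" by fastforce
  have v: "v > 0" "\<bar>q\<bar> = of_int u / of_int v"
    using quotient_of_denom_pos[OF uv] quotient_of_div[OF uv] by auto
  have "(of_int u :: rat) > 0" using v assms
    by (metis zero_less_abs_iff zero_less_divide_iff of_int_0_less_iff order_less_asym)
  hence "u > 0" by simp
  thus ?thesis using that[of "nat u" "nat v"] v by simp
qed

context
  fixes f :: "nat \<Rightarrow> complex"
  assumes f: "f \<in> completely_multiplicative"
begin

lemma cm_mult: "m > 0 \<Longrightarrow> n > 0 \<Longrightarrow> f (m * n) = f m * f n"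
  using f by (auto simp: completely_multiplicative_def)

lemma cm_norm: "n > 0 \<Longrightarrow> norm (f n) = 1"
  using f by (auto simp: completely_multiplicative_def)

lemma cm_nonzero: "n > 0 \<Longrightarrow> f n \<noteq> 0"
  using cm_norm[of n] by auto

lemma cm_one: "f 1 = 1"
  using cm_mult[of 1 1] cm_nonzero[of 1] by simp

text \<open>Cross-multiplying with the reduced fraction and applying multiplicativity shows that any
  representation gives the same value.\<close>

lemma rat_ext_divide:
  assumes "m > 0" and "n > 0"
  shows "rat_ext f (of_nat m / of_nat n) = f m / f n"
proof -
  obtain u v where uv: "quotient_of (of_nat m / of_nat n) = (u, v)" by fastforce
  have v: "v > 0" "of_nat m / of_nat n = (of_int u / of_int v :: rat)"
    using quotient_of_denom_pos[OF uv] quotient_of_div[OF uv] by auto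
  have eq: "(of_int (int m * v) :: rat) = of_int (u * int n)"
    using v assms by (simp add: field_simps)
  hence eq: "int m * v = u * int n" by (simp only: of_int_eq_iff)
  have "u > 0" using eq assms v(1)
    by (metis of_nat_0_less_iff zero_less_mult_iff order_less_asym)
  define U V where "U = nat u" and "V = nat v"
  have UV: "U > 0" "V > 0" "u = int U" "v = int V" using \<open>u > 0\<close> v by (auto simp: U_def V_def)
  have "int (m * V) = int (U * n)" using eq UV by simp
  hence "m * V = U * n" by (simp only: of_nat_eq_iff)
  hence "f m * f V = f U * f n" using cm_mult assms UV by metis
  thus ?thesis using uv UV cm_nonzero assms by (simp add: rat_ext_def field_simps)
qed

lemma rat_ext_of_nat: "n > 0 \<Longrightarrow> rat_ext f (of_nat n) = f n"
  using rat_ext_divide[of n 1] cm_one by simp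

lemma norm_rat_ext:
  assumes "q \<noteq> 0"
  shows "norm (rat_ext f q) = 1"
proof -
  obtain m n :: nat where "m > 0" "n > 0" "\<bar>q\<bar> = of_nat m / of_nat n"
    by (rule abs_rat_cases[OF assms])
  moreover from this have "norm (f m / f n) = 1" by (simp add: norm_divide cm_norm)
  ultimately show ?thesis using rat_ext_divide[of m n] rat_ext_abs[of f q] by simp
qed

lemma rat_ext_mult:
  assumes "p \<noteq> 0" and "q \<noteq> 0"
  shows "rat_ext f (p * q) = rat_ext f p * rat_ext f q"
proof -
  obtain m n :: nat where mn: "m > 0" "n > 0" "\<bar>p\<bar> = of_nat m / of_nat n"
    by (rule abs_rat_cases[OF assms(1)])
  obtain m' n' :: nat where mn': "m' > 0" "n' > 0" "\<bar>q\<bar> = of_nat m' / of_nat n'"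
    by (rule abs_rat_cases[OF assms(2)])
  have "\<bar>p * q\<bar> = of_nat (m * m') / of_nat (n * n')" using mn mn' by (simp add: abs_mult)
  hence "rat_ext f \<bar>p * q\<bar> = f (m * m') / f (n * n')"
    using rat_ext_divide[of "m * m'" "n * n'"] mn mn' by simp
  also have "\<dots> = rat_ext f \<bar>p\<bar> * rat_ext f \<bar>q\<bar>"
    using rat_ext_divide mn mn' cm_mult by simp
  finally show ?thesis by (simp only: rat_ext_abs)
qed

end

section \<open>Scaling by the coefficients and clearing denominators\<close>

theorem theorem1p4:
  fixes a b c d :: nat and f :: "nat \<Rightarrow> nat \<Rightarrow> complex" and I :: "complex set"
  assumes "a > 0" and "b > 0" and "c > 0"
    and "is_square a" and "is_square b" and "is_square c"
    and "a = c \<or> a + b = c"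
    and "d > 0"
    and "\<And>i. i \<in> {1..d} \<Longrightarrow> f i \<in> completely_multiplicative"
    and "openin (top_of_set (sphere 0 1)) I" and "1 \<in> I"
  shows "\<exists>x y z :: nat. x > 0 \<and> y > 0 \<and> z > 0 \<and>
           a * x\<^sup>2 + b * y\<^sup>2 = c * z\<^sup>2 \<and>
           (\<forall>i\<in>{1..d}. f i x \<in> I \<and> f i y \<in> I \<and> f i z \<in> I)"
proof (cases "a + b = c")
  case True
  have "\<forall>i\<in>{1..d}. f i 1 \<in> I" using cm_one[OF assms(9)] assms(11) by simp
  with True show ?thesis by (intro exI[of _ "1 :: nat"]) simp
next
  case False
  obtain A B where AB: "a = A\<^sup>2" "b = B\<^sup>2" "c = A\<^sup>2"
    using assms(4,5,7) False by (auto elim!: is_nth_powerE)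
  have pos: "A > 0" "B > 0" using assms(1,2) AB by auto
  interpret rat_characters "{1..d}" "\<lambda>i. rat_ext (f i)"
  proof
    show "rat_ext (f i) (-1) = 1" if "i \<in> {1..d}" for i
      using rat_ext_minus[of "f i" 1] rat_ext_of_nat[OF assms(9)[OF that], of 1] cm_one[OF assms(9)[OF that]]
      by simp
  qed (use norm_rat_ext rat_ext_mult assms(9) in auto)
  obtain e where e: "e > 0" "ball 1 e \<inter> sphere 0 1 \<subseteq> I"
    using assms(10,11) unfolding openin_contains_ball by blast
  \<comment> \<open>Since \<open>B * l = A\<close>, replacing \<open>y\<close> by
    \<open>l * y\<close> turns the Pythagorean equation into the one with coefficients
    \<open>A^2\<close>, \<open>B^2\<close>, \<open>A^2\<close>.\<close>
  define l :: rat where "l = of_nat A / of_nat B"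
  have l: "l \<noteq> 0" "of_nat B * l = of_nat A" using pos by (auto simp: l_def)
  obtain x y z where xyz: "x\<^sup>2 + y\<^sup>2 = z\<^sup>2" "near (e / 2) x" "near (e / 2) (l * y)" "near (e / 2) z"
    using ex_near_pythagorean[of "e / 2" l] e(1) l by auto
  obtain D :: nat where D: "D > 0" "\<forall>r\<in>{x, l * y, z}. \<exists>j::int. of_nat D * r = of_int j"
    by (rule ex_common_denominator[of "{x, l * y, z}"]) auto
  \<comment> \<open>As \<open>k > 0\<close>, the factor \<open>D ^ k\<close> still clears all
    denominators, and it costs only another \<open>e / 2\<close>.\<close>
  obtain k where k: "k > 0" "near (e / 2) (of_nat D ^ k)"
    using ex_near_power[of "e / 2" "of_nat D"] e(1) D(1) by auto
  have "\<exists>n::nat. n > 0 \<and> of_nat n = of_nat D ^ k * \<bar>r\<bar> \<and> (\<forall>i\<in>{1..d}. f i n \<in> I)"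
    if r: "r \<in> {x, l * y, z}" "near (e / 2) r" for r
  proof -
    obtain j :: int where j: "of_nat D * r = of_int j" using D(2) r(1) by blast
    have "of_nat D ^ k * r = of_nat D ^ (k - 1) * (of_nat D * r)"
      using k(1) by (simp add: power_eq_if)
    also have "\<dots> = of_int (int D ^ (k - 1) * j)" by (simp add: j)
    finally have jj: "of_nat D ^ k * r = of_int (int D ^ (k - 1) * j)" .
    define n where "n = nat \<bar>int D ^ (k - 1) * j\<bar>"
    have "of_nat n = \<bar>of_nat D ^ k * r\<bar>" unfolding jj n_def by simp
    hence n: "of_nat n = of_nat D ^ k * \<bar>r\<bar>" by (simp add: abs_mult)
    have "near (e / 2) \<bar>r\<bar>" using r(2) by (simp only: near_abs)
    with k(2) have "near (e / 2 + e / 2) (of_nat D ^ k * \<bar>r\<bar>)" by (rule near_mult)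
    hence near: "near e (of_nat n)" using n by simp
    have "n > 0" using near_nonzero[OF near] by simp
    moreover have "f i n \<in> I" if i: "i \<in> {1..d}" for i
    proof -
      have "norm (rat_ext (f i) (of_nat n) - 1) < e" using near i unfolding near_def by blast
      hence "dist 1 (f i n) < e"
        using rat_ext_of_nat[OF assms(9)[OF i] \<open>n > 0\<close>] by (simp add: dist_norm norm_minus_commute)
      thus ?thesis using e(2) cm_norm[OF assms(9)[OF i] \<open>n > 0\<close>] by auto
    qed
    ultimately show ?thesis using n by blast
  qed
  note int = this
  obtain X :: nat where X: "X > 0" "of_nat X = of_nat D ^ k * \<bar>x\<bar>" "\<forall>i\<in>{1..d}. f i X \<in> I"
    using int[of x] xyz(2) by auto
  obtain Y :: nat where Y: "Y > 0" "of_nat Y = of_nat D ^ k * \<bar>l * y\<bar>" "\<forall>i\<in>{1..d}. f i Y \<in> I"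
    using int[of "l * y"] xyz(3) by auto
  obtain Z :: nat where Z: "Z > 0" "of_nat Z = of_nat D ^ k * \<bar>z\<bar>" "\<forall>i\<in>{1..d}. f i Z \<in> I"
    using int[of z] xyz(4) by auto
  have "(of_nat (A\<^sup>2 * X\<^sup>2 + B\<^sup>2 * Y\<^sup>2) :: rat) =
      (of_nat A * of_nat D ^ k * x)\<^sup>2 + (of_nat D ^ k * (of_nat B * l) * y)\<^sup>2"
    by (simp add: X(2) Y(2) power_mult_distrib)
  also have "\<dots> = (of_nat A * of_nat D ^ k)\<^sup>2 * (x\<^sup>2 + y\<^sup>2)"
    unfolding l(2) by (simp add: power_mult_distrib algebra_simps)
  also have "\<dots> = of_nat (A\<^sup>2 * Z\<^sup>2)"
    by (simp add: xyz(1) Z(2) power_mult_distrib)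
  finally have "a * X\<^sup>2 + b * Y\<^sup>2 = c * Z\<^sup>2" unfolding AB by (simp only: of_nat_eq_iff)
  thus ?thesis using X Y Z by blast
qed

end
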